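(* Let $R(z,w)=P(Q(z,w))$, where $P$ is a polynomial in one variable and $Q$ is a polynomial in two variables, both with complex coefficients. If $Q(0,0)=0$ and $R$ is even, then $P$ is even or $Q$ is even.
   Context: A polynomial $P$ in one variable is even if $P(-z)=P(z)$ for all $z$. A polynomial $Q(z,w)$ in two variables is even if $Q(-z,-w)=Q(z,w)$ for all $z,w$ (equivalently, it has only homogeneous terms of even total degree). *)

theory Defs
  imports Complex_Main "HOL-Computational_Algebra.Polynomial"
begin

(* A polynomial in two variables z, w is a polynomial in w whose coefficients are
   polynomials in z: the monomial z^i * w^j has coefficient coeff (coeff Q j) i. *)
definition eval2 :: "'a::comm_semiring_1 poly poly \<Rightarrow> 'a \<Rightarrow> 'a \<Rightarrow> 'a" where
  "eval2 Q z w = poly (poly Q [:w:]) z"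

definition even_poly :: "'a::comm_ring_1 poly \<Rightarrow> bool" where
  "even_poly P \<longleftrightarrow> (\<forall>z. poly P (- z) = poly P z)"

definition even_poly2 :: "'a::comm_ring_1 poly poly \<Rightarrow> bool" where
  "even_poly2 Q \<longleftrightarrow> (\<forall>z w. eval2 Q (- z) (- w) = eval2 Q z w)"

end

theory Submission
  imports Defs
begin

text \<open>
  Restrict \<open>Q\<close> to a line through the origin, so that \<open>p \<circ> q\<close> is even for a one-variable \<open>q\<close>
  with \<open>q(0) = 0\<close>. Write \<open>p = a (X + s)^d + r\<close> with \<open>deg r < d - 1\<close>. Comparing growth in
  \<open>p(q(t)) = p(q(-t))\<close> forces \<open>q(-t) + s = \<plusminus>(q(t) + s)\<close>. The sign \<open>+\<close> says that \<open>q\<close> is even.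
  The sign \<open>-\<close> gives \<open>s = 0\<close> at \<open>t = 0\<close>, so \<open>q\<close> is odd and \<open>p\<close> is even. Hence if \<open>p\<close> is not
  even, then \<open>Q\<close> is even on every line through the origin.
\<close>

text \<open>The cofactor \<open>T\<close> of \<open>u - v\<close> in \<open>u ^ d - v ^ d\<close> is
  a sum of \<open>d\<close> terms with one common degree and one common leading coefficient, so in
  characteristic 0 the top terms cannot cancel.\<close>

lemma degree_power_diff_ge:
  fixes u v :: "'a::field_char_0 poly"
  assumes "u \<noteq> v" "u \<noteq> 0" "degree u = degree v" "lead_coeff u = lead_coeff v" "d > 0"
  shows "u ^ d \<noteq> v ^ d" and "degree u * (d - 1) \<le> degree (u ^ d - v ^ d)"
proof -
  define T where "T = (\<Sum>i<d. v ^ (d - Suc i) * u ^ i)"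
  let ?m = "degree u * (d - 1)"
  have eq: "u ^ d - v ^ d = (u - v) * T"
    unfolding T_def by (rule power_diff_sumr2)
  have v0: "v \<noteq> 0" using assms(2,4) by (metis leading_coeff_0_iff)
  have "coeff (v ^ (d - Suc i) * u ^ i) ?m = lead_coeff u ^ (d - 1)" if "i < d" for i
  proof -
    have "degree (v ^ (d - Suc i) * u ^ i) = (d - Suc i) * degree u + i * degree u"
      using assms v0 by (simp add: degree_mult_eq degree_power_eq)
    also have "\<dots> = (d - Suc i + i) * degree u"
      by (simp only: distrib_right)
    also have "d - Suc i + i = d - 1"
      using that by simp
    finally have deg: "degree (v ^ (d - Suc i) * u ^ i) = ?m"
      by (simp add: mult.commute)
    have "lead_coeff (v ^ (d - Suc i) * u ^ i) = lead_coeff u ^ (d - Suc i + i)"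
      using assms(4) by (simp add: lead_coeff_mult lead_coeff_power power_add)
    with deg that show ?thesis by simp
  qed
  hence "coeff T ?m = of_nat d * lead_coeff u ^ (d - 1)"
    unfolding T_def by (simp add: coeff_sum)
  moreover have "lead_coeff u \<noteq> 0"
    using assms(2) by simp
  ultimately have T: "coeff T ?m \<noteq> 0"
    using assms(5) by (simp del: leading_coeff_0_iff)
  hence "T \<noteq> 0" by auto
  with eq assms(1) show "u ^ d \<noteq> v ^ d" by auto
  have "?m \<le> degree T" using T by (rule le_degree)
  thus "?m \<le> degree (u ^ d - v ^ d)"
    using eq \<open>T \<noteq> 0\<close> assms(1) by (simp add: degree_mult_eq)
qed

text \<open>Completing the power, as one completes the square: \<open>s\<close> is chosen to match
  the coefficient just below the leading one. The case \<open>r = 0\<close> stands apart because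
  \<open>degree 0 = 0\<close> violates the strict bound when \<open>p\<close> is linear.\<close>

lemma complete_power_poly:
  fixes p :: "'a::field_char_0 poly"
  assumes "degree p > 0"
  obtains s r where "p = smult (lead_coeff p) ([:s, 1:] ^ degree p) + r"
    and "r = 0 \<or> degree r < degree p - 1"
proof
  define d where "d = degree p"
  define s where "s = coeff p (d - 1) / (of_nat d * lead_coeff p)"
  define r where "r = p - smult (lead_coeff p) ([:s, 1:] ^ d)"
  show "p = smult (lead_coeff p) ([:s, 1:] ^ degree p) + r"
    by (simp add: r_def d_def)
  have d0: "d > 0" and p0: "p \<noteq> 0" using assms by (auto simp: d_def)
  have "coeff r i = 0" if "i \<ge> d - 1" for i
  proof -
    consider "i = d - 1" | "i = d" | "i > d" using \<open>i \<ge> d - 1\<close> by linarith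
    thus ?thesis
    proof cases
      case 1
      have "d choose (d - 1) = d"
        using d0 binomial_symmetric[of 1 d] by simp
      with 1 d0 p0 show ?thesis
        by (simp add: r_def s_def coeff_linear_poly_power)
    next
      case 2
      thus ?thesis
        by (simp add: r_def coeff_linear_poly_power d_def)
    next
      case 3
      thus ?thesis
        by (simp add: r_def coeff_eq_0 degree_linear_power d_def)
    qed
  qed
  thus "r = 0 \<or> degree r < degree p - 1"
    unfolding d_def [symmetric] by (metis leading_coeff_0_iff not_le)
qed

lemma pcompose_power: "pcompose (p ^ n) q = pcompose p q ^ n"
  for p q :: "'a::comm_semiring_1 poly"
  by (induction n) (simp_all add: pcompose_mult pcompose_1)

text \<open>The shift \<open>s\<close> completes the power of \<open>p\<close> and so is fixed
  before \<open>x\<close> and \<open>y\<close>. If the two sides of the conclusion differed, their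
  \<open>d\<close>-th powers would differ in degree at least \<open>(d - 1) * degree x\<close>, more
  than the remainder \<open>r\<close> can compensate.\<close>

lemma pcompose_eq_imp_affine:
  fixes p :: "'a::field_char_0 poly"
  assumes "degree p > 0"
  obtains s where
    "\<And>x y \<omega>. \<lbrakk>degree x > 0; degree y = degree x; lead_coeff y = \<omega> * lead_coeff x;
       pcompose p x = pcompose p y\<rbrakk> \<Longrightarrow> y + [:s:] = smult \<omega> (x + [:s:])"
proof -
  define d where "d = degree p"
  define a where "a = lead_coeff p"
  obtain s r where p: "p = smult a ([:s, 1:] ^ d) + r" and r: "r = 0 \<or> degree r < d - 1"
    using complete_power_poly [OF assms] unfolding a_def d_def by blast
  have a: "a \<noteq> 0" and d: "d > 0" using assms by (auto simp: a_def d_def)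
  show thesis
  proof (rule that, rule ccontr)
    fix x y :: "'a poly" and \<omega> :: 'a
    assume x: "degree x > 0" and deg: "degree y = degree x"
      and lc: "lead_coeff y = \<omega> * lead_coeff x" and eq: "pcompose p x = pcompose p y"
      and ne: "y + [:s:] \<noteq> smult \<omega> (x + [:s:])"
    have "x \<noteq> 0" "y \<noteq> 0" using x deg by auto
    hence \<omega>0: "\<omega> \<noteq> 0" using lc by auto
    \<comment> \<open>Comparing leading coefficients makes \<open>\<omega>\<close> a
      \<open>d\<close>-th root of unity, so it disappears from \<open>?v ^ d\<close> below.\<close>
    have "lead_coeff (pcompose p x) = lead_coeff (pcompose p y)" by (simp only: eq)
    hence "a * lead_coeff x ^ d = a * lead_coeff y ^ d"
      using x deg by (simp add: lead_coeff_comp a_def d_def)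
    hence "lead_coeff x ^ d = \<omega> ^ d * lead_coeff x ^ d"
      using a lc by (simp add: power_mult_distrib)
    hence \<omega>: "\<omega> ^ d = 1" using \<open>x \<noteq> 0\<close> by simp
    let ?u = "y + [:s:]" and ?v = "smult \<omega> (x + [:s:])"
    have du: "degree ?u = degree x" using x deg by (simp add: degree_add_eq_left)
    have dv: "degree ?v = degree x" using x \<omega>0 by (simp add: degree_add_eq_left)
    have lcs: "lead_coeff ?u = lead_coeff ?v"
      unfolding du dv using x lc deg by (simp add: coeff_eq_0)
    have "?u \<noteq> 0" using du x by force
    note * = degree_power_diff_ge [OF ne this du [folded dv] lcs d]
    have comp: "pcompose p z = smult a ((z + [:s:]) ^ d) + pcompose r z" for z
      unfolding p
      by (simp add: pcompose_add pcompose_smult pcompose_power pcompose_pCons add.commute)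
    have "?v ^ d = (x + [:s:]) ^ d" using \<omega> by (simp add: smult_power)
    hence diff: "smult a (?u ^ d - ?v ^ d) = pcompose r x - pcompose r y"
      using eq by (simp add: comp smult_diff_right algebra_simps)
    have "r \<noteq> 0"
    proof
      assume "r = 0"
      with diff a *(1) show False by simp
    qed
    have "degree (?u ^ d - ?v ^ d) = degree (pcompose r x - pcompose r y)"
      using a by (simp flip: diff)
    also have "\<dots> \<le> degree r * degree x"
      by (rule degree_diff_le) (simp_all add: degree_pcompose deg)
    also have "\<dots> < (d - 1) * degree x"
      using r \<open>r \<noteq> 0\<close> x by simp
    finally show False using *(2) du by (simp add: mult.commute)
  qed
qed

lemma even_pcompose_imp:
  fixes p q :: "'a::field_char_0 poly"
  assumes eq: "pcompose p (pcompose q [:0, -1:]) = pcompose p q" and q0: "poly q 0 = 0"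
  shows "pcompose p [:0, -1:] = p \<or> pcompose q [:0, -1:] = q"
proof (cases "degree p = 0 \<or> degree q = 0")
  case True
  thus ?thesis by (auto elim!: degree_eq_zeroE simp: pcompose_pCons)
next
  case False
  \<comment> \<open>Reflection multiplies the leading coefficient by \<open>?\<omega>\<close>, so
    the parity of \<open>degree q\<close> decides which of \<open>p\<close> and \<open>q\<close> is
    shown to be even.\<close>
  let ?q = "pcompose q [:0, -1:]" and ?\<omega> = "(-1) ^ degree q :: 'a"
  obtain s where s: "\<And>x y \<omega>. \<lbrakk>degree x > 0; degree y = degree x; lead_coeff y = \<omega> * lead_coeff x;
       pcompose p x = pcompose p y\<rbrakk> \<Longrightarrow> y + [:s:] = smult \<omega> (x + [:s:])"
    using pcompose_eq_imp_affine [of p] False by auto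
  have "lead_coeff ?q = ?\<omega> * lead_coeff q"
    by (subst lead_coeff_comp) auto
  hence *: "?q + [:s:] = smult ?\<omega> (q + [:s:])"
    using False eq by (intro s) (auto simp: degree_pcompose)
  show ?thesis
  proof (cases "even (degree q)")
    case True
    thus ?thesis using * by simp
  next
    case False
    \<comment> \<open>Both \<open>q\<close> and \<open>?q\<close> vanish at 0, which isolates the
      shift.\<close>
    have "poly (?q + [:s:]) 0 = poly (smult ?\<omega> (q + [:s:])) 0" by (simp only: *)
    with False have "s = - s" by (simp add: poly_pcompose q0)
    hence "s = 0" by simp
    with * False have "?q = pcompose [:0, -1:] q" by (simp add: pcompose_pCons)
    \<comment> \<open>Since \<open>q\<close> is odd, reflecting its argument amounts to reflecting
      the argument of \<open>p\<close>; the nonconstant \<open>q\<close> is then cancelled on the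
      right.\<close>
    hence "pcompose (pcompose p [:0, -1:] - p) q = 0"
      using eq by (simp only: pcompose_diff pcompose_assoc [symmetric] right_minus_eq)
    moreover have "degree q > 0"
      using \<open>\<not> (degree p = 0 \<or> degree q = 0)\<close> by simp
    ultimately have "pcompose p [:0, -1:] - p = 0"
      by (rule pcompose_eq_0)
    thus ?thesis by simp
  qed
qed

lemma even_poly_iff_pcompose:
  fixes p :: "'a::field_char_0 poly"
  shows "even_poly p \<longleftrightarrow> pcompose p [:0, -1:] = p"
  by (simp add: even_poly_def poly_pcompose fun_eq_iff flip: poly_eq_poly_eq_iff)

lemma eval2_line:
  obtains q where "\<And>t. poly q t = eval2 Q (t * a) (t * b)"
proof (induction Q arbitrary: thesis)
  case 0
  show ?case by (rule 0 [of 0]) (simp add: eval2_def)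
next
  case (pCons c Q)
  obtain q where "\<And>t. poly q t = eval2 Q (t * a) (t * b)"
    using pCons.IH by blast
  thus ?case
    by (intro pCons.prems [of "pcompose c [:0, a:] + [:0, b:] * q"])
       (simp add: eval2_def poly_pcompose algebra_simps)
qed

theorem theorem29:
  fixes P :: "complex poly" and Q R :: "complex poly poly"
  assumes "\<forall>z w. eval2 R z w = poly P (eval2 Q z w)"
    and "eval2 Q 0 0 = 0"
    and "even_poly2 R"
  shows "even_poly P \<or> even_poly2 Q"
proof (rule disjCI)
  assume Q: "\<not> even_poly2 Q"
  then obtain z w where zw: "eval2 Q (- z) (- w) \<noteq> eval2 Q z w"
    by (auto simp: even_poly2_def)
  \<comment> \<open>This line passes through a point where evenness of \<open>Q\<close> fails; the
    parameters 1 and -1 give that point and its reflection, so \<open>q\<close> is not even.\<close>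
  obtain q where q: "\<And>t. poly q t = eval2 Q (t * z) (t * w)"
    using eval2_line by blast
  have "pcompose P (pcompose q [:0, -1:]) = pcompose P q"
    using assms(1,3)
    by (simp add: even_poly2_def poly_pcompose q fun_eq_iff flip: poly_eq_poly_eq_iff)
  moreover have "poly q 0 = 0"
    using assms(2) by (simp add: q)
  moreover have "\<not> even_poly q"
    using zw q [of 1] q [of "-1"] unfolding even_poly_def by (metis mult_1 mult_minus1)
  ultimately show "even_poly P"
    using even_pcompose_imp [of P q] unfolding even_poly_iff_pcompose by blast
qed

end
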